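(* Let $X$ be a regular curve and let $f:X\to X$ be a homeomorphism with at least one wandering point. Then $h_{\mathrm{pol}}(2^f)=+\infty$.
   Context: A continuum is a nonempty connected compact metric space. A continuum $X$ is a regular curve if for each $x\in X$ and each open neighbourhood $U$ of $x$ in $X$ there exists an open neighbourhood $V$ of $x$ in $X$ such that $V\subset U$ and the boundary $\partial V$ is finite. Polynomial entropy: let $(Y,d)$ be a compact metric space and $g:Y\to Y$ continuous. For $m\geq 1$ put $d_m^g(x,y)=\max_{0\leq k\leq m-1}d(g^k(x),g^k(y))$. For $\varepsilon>0$, a finite set $E\subset Y$ is $(m,\varepsilon)$-separated if $d_m^g(x,y)\geq\varepsilon$ for all distinct $x,y\in E$; $\mathrm{sep}(m,\varepsilon)$ denotes the maximal cardinality of an $(m,\varepsilon)$-separated subset of $Y$. Then $$h_{\mathrm{pol}}(g)=\lim_{\varepsilon\to 0}\limsup_{m\to\infty}\frac{\log \mathrm{sep}(m,\varepsilon)}{\log m}\in[0,+\infty].$$ A set $A\subset X$ is wandering (for $f$) if $f^k(A)\cap A=\emptyset$ for all $k\geq 1$. A point $p\in X$ is wandering if it has a wandering neighbourhood $U\ni p$. For a compact metric space $X$, the hyperspace $2^X$ is the set of all nonempty closed subsets of $X$, a compact metric space with the Hausdorff metric. The induced map $2^f:2^X\to 2^X$ is $2^f(A)=\{f(x)\mid x\in A\}$. *)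

theory Defs
  imports "HOL-Analysis.Analysis"
begin

definition continuum :: "'a::metric_space set \<Rightarrow> bool" where
  "continuum X \<longleftrightarrow> X \<noteq> {} \<and> compact X \<and> connected X"

text \<open>Openness and boundaries are relative to the subspace \<open>X\<close>.\<close>

definition regular_curve :: "'a::metric_space set \<Rightarrow> bool" where
  "regular_curve X \<longleftrightarrow> continuum X \<and>
    (\<forall>x\<in>X. \<forall>U. openin (top_of_set X) U \<and> x \<in> U \<longrightarrow>
      (\<exists>V. openin (top_of_set X) V \<and> x \<in> V \<and> V \<subseteq> U \<and> finite (top_of_set X frontier_of V)))"

definition wandering :: "('a \<Rightarrow> 'a) \<Rightarrow> 'a set \<Rightarrow> bool" where
  "wandering f A \<longleftrightarrow> (\<forall>k\<ge>1. (f ^^ k) ` A \<inter> A = {})"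

text \<open>A neighbourhood of \<open>p\<close> is a subset of \<open>X\<close> having \<open>p\<close> in its relative interior; it
  need not be open.\<close>

definition wandering_point :: "'a::metric_space set \<Rightarrow> ('a \<Rightarrow> 'a) \<Rightarrow> 'a \<Rightarrow> bool" where
  "wandering_point X f p \<longleftrightarrow>
    (\<exists>U\<subseteq>X. p \<in> top_of_set X interior_of U \<and> wandering f U)"

text \<open>The metric is an explicit argument of the following notions, so that they apply to
  hyperspaces, whose elements are sets.\<close>

definition dyn_dist :: "('b \<Rightarrow> 'b \<Rightarrow> real) \<Rightarrow> ('b \<Rightarrow> 'b) \<Rightarrow> nat \<Rightarrow> 'b \<Rightarrow> 'b \<Rightarrow> real" where
  "dyn_dist d g m x y = (MAX k\<in>{..<m}. d ((g ^^ k) x) ((g ^^ k) y))"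

definition separated ::
    "'b set \<Rightarrow> ('b \<Rightarrow> 'b \<Rightarrow> real) \<Rightarrow> ('b \<Rightarrow> 'b) \<Rightarrow> nat \<Rightarrow> real \<Rightarrow> 'b set \<Rightarrow> bool" where
  "separated Y d g m \<epsilon> E \<longleftrightarrow> finite E \<and> E \<subseteq> Y \<and>
    (\<forall>x\<in>E. \<forall>y\<in>E. x \<noteq> y \<longrightarrow> dyn_dist d g m x y \<ge> \<epsilon>)"

definition sep :: "'b set \<Rightarrow> ('b \<Rightarrow> 'b \<Rightarrow> real) \<Rightarrow> ('b \<Rightarrow> 'b) \<Rightarrow> nat \<Rightarrow> real \<Rightarrow> nat" where
  "sep Y d g m \<epsilon> = Max {card E | E. separated Y d g m \<epsilon> E}"

definition pol_entropy :: "'b set \<Rightarrow> ('b \<Rightarrow> 'b \<Rightarrow> real) \<Rightarrow> ('b \<Rightarrow> 'b) \<Rightarrow> ereal" where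
  "pol_entropy Y d g =
    Lim (at_right 0) (\<lambda>\<epsilon>. limsup (\<lambda>m. ereal (ln (real (sep Y d g m \<epsilon>)) / ln (real m))))"

definition hyperspace :: "'a::metric_space set \<Rightarrow> 'a set set" where
  "hyperspace X = {A. A \<noteq> {} \<and> closedin (top_of_set X) A}"

definition hausdorff_dist :: "'a::metric_space set \<Rightarrow> 'a set \<Rightarrow> real" where
  "hausdorff_dist A B = max (SUP a\<in>A. infdist a B) (SUP b\<in>B. infdist b A)"

definition hyperspace_map :: "('a \<Rightarrow> 'a) \<Rightarrow> 'a set \<Rightarrow> 'a set" where
  "hyperspace_map f A = f ` A"

lemma hyperspace_compact:
  assumes "compact X" "A \<in> hyperspace X"
  shows "compact A" "A \<noteq> {}" "A \<subseteq> X"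
  using assms closedin_compact[of X A] closedin_subset[of "top_of_set X" A]
  by (auto simp: hyperspace_def)

lemma bdd_above_infdist:
  fixes A :: "'a::metric_space set"
  assumes "compact A"
  shows "bdd_above ((\<lambda>a. infdist a B) ` A)"
  using assms
  by (intro bounded_imp_bdd_above compact_imp_bounded compact_continuous_image
      continuous_on_infdist continuous_on_id)

lemma hausdorff_dist_le_iff:
  fixes A B :: "'a::metric_space set"
  assumes "compact A" "A \<noteq> {}" "compact B" "B \<noteq> {}"
  shows "hausdorff_dist A B \<le> r \<longleftrightarrow> (\<forall>a\<in>A. infdist a B \<le> r) \<and> (\<forall>b\<in>B. infdist b A \<le> r)"
  using assms by (simp add: hausdorff_dist_def cSUP_le_iff bdd_above_infdist)

text \<open>On the hyperspace of a compact set, the Hausdorff distance satisfies the metric axioms.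
  (It is unspecified on empty or unbounded sets, so it is not a \<open>Metric_space\<close> distance
  without restricting it to the carrier.)\<close>

lemma hausdorff_dist_commute: "hausdorff_dist A B = hausdorff_dist B A"
  by (simp add: hausdorff_dist_def max.commute)

lemma hausdorff_dist_nonneg:
  fixes X :: "'a::metric_space set"
  assumes X: "compact X" and A: "A \<in> hyperspace X" and B: "B \<in> hyperspace X"
  shows "0 \<le> hausdorff_dist A B"
proof -
  note cA = hyperspace_compact[OF X A] and cB = hyperspace_compact[OF X B]
  obtain a where "a \<in> A" using cA by blast
  then have "infdist a B \<le> hausdorff_dist A B"
    using hausdorff_dist_le_iff[OF cA(1,2) cB(1,2), of "hausdorff_dist A B"] by blast
  then show ?thesis using infdist_nonneg[of a B] by linarith
qed

lemma hausdorff_dist_eq_0_iff: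
  fixes X :: "'a::metric_space set"
  assumes X: "compact X" and A: "A \<in> hyperspace X" and B: "B \<in> hyperspace X"
  shows "hausdorff_dist A B = 0 \<longleftrightarrow> A = B"
proof -
  note cA = hyperspace_compact[OF X A] and cB = hyperspace_compact[OF X B]
  have eq: "infdist x C \<le> 0 \<longleftrightarrow> x \<in> C" if "compact C" "C \<noteq> {}" for x :: 'a and C
    using in_closed_iff_infdist_zero[OF compact_imp_closed[OF that(1)] that(2), of x]
      infdist_nonneg[of x C] by linarith
  have "hausdorff_dist A B = 0 \<longleftrightarrow> hausdorff_dist A B \<le> 0"
    using hausdorff_dist_nonneg[OF X A B] by linarith
  also have "\<dots> \<longleftrightarrow> A = B"
    using cA cB by (auto simp: hausdorff_dist_le_iff eq)
  finally show ?thesis .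
qed

lemma hausdorff_dist_triangle:
  fixes X :: "'a::metric_space set"
  assumes X: "compact X"
    and A: "A \<in> hyperspace X" and B: "B \<in> hyperspace X" and C: "C \<in> hyperspace X"
  shows "hausdorff_dist A C \<le> hausdorff_dist A B + hausdorff_dist B C"
proof -
  have *: "infdist a R \<le> hausdorff_dist P Q + hausdorff_dist Q R"
    if P: "P \<in> hyperspace X" and Q: "Q \<in> hyperspace X" and R: "R \<in> hyperspace X"
      and a: "a \<in> P" for P Q R a
  proof -
    note cP = hyperspace_compact[OF X P] and cQ = hyperspace_compact[OF X Q]
      and cR = hyperspace_compact[OF X R]
    have "infdist a R - hausdorff_dist Q R \<le> dist a q" if q: "q \<in> Q" for q
    proof -
      have "infdist q R \<le> hausdorff_dist Q R"
        using hausdorff_dist_le_iff[OF cQ(1,2) cR(1,2), of "hausdorff_dist Q R"] q by auto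
      with infdist_triangle[of a R q] show ?thesis by linarith
    qed
    then have "infdist a R - hausdorff_dist Q R \<le> infdist a Q"
      unfolding infdist_notempty[OF cQ(2)] by (intro cINF_greatest cQ(2))
    moreover have "infdist a Q \<le> hausdorff_dist P Q"
      using hausdorff_dist_le_iff[OF cP(1,2) cQ(1,2), of "hausdorff_dist P Q"] a by auto
    ultimately show ?thesis by linarith
  qed
  show ?thesis
    using *[OF A B C] *[OF C B A] hyperspace_compact[OF X A] hyperspace_compact[OF X C]
    by (simp add: hausdorff_dist_le_iff hausdorff_dist_commute[of C B]
        hausdorff_dist_commute[of B A] add.commute)
qed

text \<open>The maximum defining \<^const>\<open>sep\<close> is over a finite set here: on the hyperspace of a
  compact set the separated sets have bounded cardinality.\<close>

lemma finite_card_separated_hyperspace: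
  fixes X :: "'a::metric_space set" and g :: "'a set \<Rightarrow> 'a set"
  assumes X: "compact X" and g: "g ` hyperspace X \<subseteq> hyperspace X"
    and m: "m \<ge> 1" and \<epsilon>: "\<epsilon> > 0"
  shows "finite {card E | E. separated (hyperspace X) hausdorff_dist g m \<epsilon> E}"
proof -
  obtain F where F: "finite F" "X \<subseteq> (\<Union>p\<in>F. ball p (\<epsilon> / 4))"
    using compactE_image[OF X, of X "\<lambda>p. ball p (\<epsilon> / 4)"] \<epsilon>
    by (metis (no_types, lifting) UN_I centre_in_ball divide_pos_pos open_ball subsetI zero_less_numeral)
  define T where "T A = {p\<in>F. ball p (\<epsilon> / 4) \<inter> A \<noteq> {}}" for A
  have close: "hausdorff_dist A B \<le> \<epsilon> / 2"
    if A: "A \<in> hyperspace X" and B: "B \<in> hyperspace X" and T: "T A = T B" for A B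
  proof -
    have *: "infdist a Q \<le> \<epsilon> / 2" if "P \<in> hyperspace X" "T P = T Q" "a \<in> P" for P Q a
    proof -
      have "a \<in> X" using that hyperspace_compact[OF X] by blast
      then obtain p where p: "p \<in> F" "a \<in> ball p (\<epsilon> / 4)" using F by blast
      then have "p \<in> T P" using that(3) unfolding T_def by blast
      then have "p \<in> T Q" using that(2) by simp
      then obtain q where q: "q \<in> Q" "q \<in> ball p (\<epsilon> / 4)" unfolding T_def by blast
      have "dist a q \<le> \<epsilon> / 2"
        using dist_triangle3[of a q p] p q by simp
      then show ?thesis using infdist_le2[OF q(1)] by blast
    qed
    show ?thesis
      unfolding hausdorff_dist_le_iff[OF hyperspace_compact(1,2)[OF X A] hyperspace_compact(1,2)[OF X B]]
      using *[OF A T] *[OF B T[symmetric]] by blast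
  qed
  define code where "code A = map (\<lambda>k. T ((g ^^ k) A)) [0..<m]" for A
  define L where "L = {xs. set xs \<subseteq> Pow F \<and> length xs = m}"
  have "finite L" unfolding L_def using F by (intro finite_lists_length_eq) simp
  have iter: "(g ^^ k) A \<in> hyperspace X" if "A \<in> hyperspace X" for A k
    using that g by (induction k) auto
  have "card E \<le> card L" if E: "separated (hyperspace X) hausdorff_dist g m \<epsilon> E" for E
  proof (rule card_inj_on_le[OF _ _ \<open>finite L\<close>])
    show "code ` E \<subseteq> L" by (auto simp: L_def code_def T_def)
    show "inj_on code E"
    proof (rule inj_onI, rule ccontr)
      fix A B assume AB: "A \<in> E" "B \<in> E" "code A = code B" "A \<noteq> B"
      have h: "A \<in> hyperspace X" "B \<in> hyperspace X" using AB E by (auto simp: separated_def)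
      have "hausdorff_dist ((g ^^ k) A) ((g ^^ k) B) \<le> \<epsilon> / 2" if "k < m" for k
        using AB(3) that h by (intro close iter) (auto simp: code_def)
      then have "dyn_dist hausdorff_dist g m A B \<le> \<epsilon> / 2"
        unfolding dyn_dist_def using m by (subst Max_le_iff) (auto simp: lessThan_empty_iff)
      moreover have "\<epsilon> \<le> dyn_dist hausdorff_dist g m A B"
        using E AB by (auto simp: separated_def)
      ultimately show False using \<epsilon> by linarith
    qed
  qed
  then have "{card E | E. separated (hyperspace X) hausdorff_dist g m \<epsilon> E} \<subseteq> {..card L}" by auto
  then show ?thesis by (rule finite_subset) simp
qed

end

theory Submission
  imports Defs "HOL-Real_Asymp.Real_Asymp"
begin

text \<open>
  Let \<open>U\<close> be a wandering neighbourhood of \<open>p\<close> and let \<open>g\<close> be the inverse of \<open>f\<close>. Neither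
  an iterate \<open>f\<^sup>k(p)\<close> nor a preimage \<open>g\<^sup>k(p)\<close> with \<open>k \<ge> 1\<close> lies in \<open>U\<close>. A finite
  set of the form \<open>{g\<^sup>j(p) | j \<in> S}\<close> therefore records \<open>S\<close> in its itinerary under \<open>2\<^sup>f\<close>: its image
  after \<open>i\<close> steps contains \<open>p\<close> when \<open>i \<in> S\<close>, and misses \<open>U\<close> when \<open>i \<notin> S\<close>. If \<open>U\<close> contains
  the ball of radius \<open>r\<close> about \<open>p\<close>, then two such sets whose index sets differ at \<open>i\<close> have images
  after \<open>i\<close> steps at Hausdorff distance at least \<open>r\<close>. Letting \<open>S\<close> run through the subsets of
  \<open>{0, \<dots>, m - 1}\<close> gives \<open>2\<^sup>m\<close> separated points of the hyperspace, at a scale independent of \<open>m\<close>.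

  Exponential growth of the separation numbers exceeds every polynomial rate, so the polynomial
  entropy is infinite.
\<close>

lemma funpow_hyperspace_map: "(hyperspace_map f ^^ k) A = (f ^^ k) ` A"
  by (induction k) (auto simp: hyperspace_map_def image_image)

lemma hyperspace_map_in_hyperspace:
  assumes "compact X" "continuous_on X f" "f ` X \<subseteq> X" "A \<in> hyperspace X"
  shows "hyperspace_map f A \<in> hyperspace X"
proof -
  note A = hyperspace_compact[OF assms(1,4)]
  have "compact (f ` A)"
    using A assms(2) by (blast intro: compact_continuous_image continuous_on_subset)
  then have "closedin (top_of_set X) (f ` A)"
    using A assms(3) by (intro closed_subset compact_imp_closed) auto
  then show ?thesis
    using A by (simp add: hyperspace_def hyperspace_map_def)
qed

lemma finite_in_hyperspace:
  assumes "finite A" "A \<noteq> {}" "A \<subseteq> X"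
  shows "A \<in> hyperspace X"
  using assms by (simp add: hyperspace_def closed_subset finite_imp_closed)

lemma funpow_in_invariant:
  assumes "f ` X \<subseteq> X" "x \<in> X"
  shows "(f ^^ n) x \<in> X"
  using assms by (induction n) auto

lemma funpow_left_inverse_on:
  assumes "g ` X \<subseteq> X" "\<And>x. x \<in> X \<Longrightarrow> f (g x) = x" "x \<in> X"
  shows "(f ^^ n) ((g ^^ n) x) = x"
proof (induction n)
  case (Suc n)
  have "(g ^^ n) x \<in> X"
    using assms by (intro funpow_in_invariant) auto
  then show ?case
    using Suc assms(2) by (simp add: funpow_swap1[of f n])
qed simp

text \<open>For \<open>i < j\<close> the point in question is a preimage of \<open>p\<close> under an iterate of \<open>f\<close>, so that \<open>p\<close>
  would lie both in \<open>U\<close> and in an iterate of \<open>U\<close> if the preimage were in \<open>U\<close>.\<close>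

lemma wandering_two_sided_orbit:
  assumes wand: "wandering f U" and p: "p \<in> X" "p \<in> U"
    and g: "g ` X \<subseteq> X" and fg: "\<And>x. x \<in> X \<Longrightarrow> f (g x) = x"
    and ij: "i \<noteq> j"
  shows "(f ^^ i) ((g ^^ j) p) \<notin> U"
proof (cases "j < i")
  case True
  then have "(f ^^ i) ((g ^^ j) p) = (f ^^ (i - j)) ((f ^^ j) ((g ^^ j) p))"
    using fun_cong[OF funpow_add[of "i - j" j f]] True by simp
  also have "\<dots> = (f ^^ (i - j)) p"
    using funpow_left_inverse_on[OF g fg p(1)] by simp
  finally show ?thesis
    using wand p(2) True unfolding wandering_def by (auto dest!: spec[of _ "i - j"])
next
  case False
  have gX: "(g ^^ (j - i)) p \<in> X"
    using g p(1) by (rule funpow_in_invariant)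
  have "(g ^^ j) p = (g ^^ i) ((g ^^ (j - i)) p)"
    using fun_cong[OF funpow_add[of i "j - i" g]] False by simp
  then have "(f ^^ i) ((g ^^ j) p) = (g ^^ (j - i)) p"
    using funpow_left_inverse_on[OF g fg gX] by simp
  moreover have "(g ^^ (j - i)) p \<notin> U"
  proof
    assume "(g ^^ (j - i)) p \<in> U"
    then have "p \<in> (f ^^ (j - i)) ` U"
      using funpow_left_inverse_on[OF g fg p(1), of "j - i"] by (metis image_eqI)
    then show False
      using wand p(2) False ij unfolding wandering_def by (auto dest!: spec[of _ "j - i"])
  qed
  ultimately show ?thesis by simp
qed

text \<open>The index \<open>m\<close> is added to every \<open>S \<subseteq> {..<m}\<close> so that the empty index set also gives a
  nonempty closed set; it is not visited by the itinerary of length \<open>m\<close>.\<close>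

lemma sep_hyperspace_ge_power:
  fixes X :: "'a::metric_space set"
  assumes X: "compact X" and hom: "homeomorphism X X f g"
    and wand: "wandering f U" and p: "p \<in> X" and ball: "ball p r \<inter> X \<subseteq> U"
    and r: "0 < \<epsilon>" "\<epsilon> \<le> r" and m: "1 \<le> m"
  shows "2 ^ m \<le> sep (hyperspace X) hausdorff_dist (hyperspace_map f) m \<epsilon>"
proof -
  have fX: "f ` X \<subseteq> X" and gX: "g ` X \<subseteq> X" and fg: "\<And>x. x \<in> X \<Longrightarrow> f (g x) = x"
    using hom by (auto simp: homeomorphism_def)
  have pU: "p \<in> U"
    using p ball r by auto
  define A where "A S = (\<lambda>j. (g ^^ j) p) ` insert m S" for S
  let ?\<S> = "Pow {..<m}"
  have orbit_in_X: "(f ^^ i) ((g ^^ j) p) \<in> X" for i j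
    using funpow_in_invariant[OF fX] funpow_in_invariant[OF gX p] .
  have orbit_in_U: "i = j" if "(f ^^ i) ((g ^^ j) p) \<in> U" for i j
    using wandering_two_sided_orbit[OF wand p pU gX fg] that by blast
  have A: "(f ^^ i) ` A S \<noteq> {}" "finite ((f ^^ i) ` A S)" "(f ^^ i) ` A S \<subseteq> X"
    if "S \<in> ?\<S>" for S i
    using orbit_in_X finite_subset[of S "{..<m}"] that by (auto simp: A_def)
  have hit: "p \<in> (f ^^ i) ` A S" if "i \<in> S" for i S
    using that funpow_left_inverse_on[OF gX fg p, of i]
    unfolding A_def image_image by (intro image_eqI[of _ _ i]) simp_all
  have miss: "(f ^^ i) ` A S \<inter> U = {}" if "i \<notin> S" "i < m" for i S
    using that by (auto simp: A_def dest: orbit_in_U)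
  have inj: "inj_on A ?\<S>"
  proof (rule inj_onI)
    fix S T assume "S \<in> ?\<S>" "T \<in> ?\<S>" "A S = A T"
    then have "i \<in> S \<longleftrightarrow> i \<in> T" if "i < m" for i
      using hit[of i] miss[of i] pU that by (metis disjoint_iff)
    then show "S = T"
      using \<open>S \<in> ?\<S>\<close> \<open>T \<in> ?\<S>\<close> by blast
  qed
  have far: "\<epsilon> \<le> hausdorff_dist ((f ^^ i) ` A S) ((f ^^ i) ` A T)"
    if ST: "S \<in> ?\<S>" "T \<in> ?\<S>" and i: "i \<in> S" "i \<notin> T" for S T i
  proof -
    have "i < m" using ST i by auto
    have "r \<le> infdist p ((f ^^ i) ` A T)"
      unfolding infdist_notempty[OF A(1)[OF ST(2)]]
    proof (rule cINF_greatest[OF A(1)[OF ST(2)]])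
      fix y assume "y \<in> (f ^^ i) ` A T"
      then have "y \<in> X" "y \<notin> U"
        using A(3)[OF ST(2)] miss[OF i(2) \<open>i < m\<close>] by blast+
      then show "r \<le> dist p y"
        using ball by (auto simp: not_less[symmetric])
    qed
    also have "\<dots> \<le> hausdorff_dist ((f ^^ i) ` A S) ((f ^^ i) ` A T)"
      using A(1,2)[OF ST(1)] A(1,2)[OF ST(2)] hit[OF i(1)] hausdorff_dist_le_iff
      by (metis finite_imp_compact order_refl)
    finally show ?thesis using r by linarith
  qed
  have "separated (hyperspace X) hausdorff_dist (hyperspace_map f) m \<epsilon> (A ` ?\<S>)"
    unfolding separated_def
  proof (intro conjI ballI impI)
    show "finite (A ` ?\<S>)" by simp
    show "A ` ?\<S> \<subseteq> hyperspace X"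
      using A[of _ 0] by (auto intro!: finite_in_hyperspace)
  next
    fix B C assume "B \<in> A ` ?\<S>" "C \<in> A ` ?\<S>" "B \<noteq> C"
    then obtain S T where ST: "S \<in> ?\<S>" "T \<in> ?\<S>" "B = A S" "C = A T" "S \<noteq> T"
      by blast
    then obtain i where i: "i \<in> S \<and> i \<notin> T \<or> i \<in> T \<and> i \<notin> S"
      by blast
    then have "i < m" using ST by auto
    have "\<epsilon> \<le> hausdorff_dist ((hyperspace_map f ^^ i) B) ((hyperspace_map f ^^ i) C)"
      using i far[of S T i] far[of T S i] ST by (auto simp: funpow_hyperspace_map hausdorff_dist_commute)
    also have "\<dots> \<le> dyn_dist hausdorff_dist (hyperspace_map f) m B C"
      unfolding dyn_dist_def using \<open>i < m\<close> by (intro Max_ge) auto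
    finally show "\<epsilon> \<le> dyn_dist hausdorff_dist (hyperspace_map f) m B C" .
  qed
  moreover have "card (A ` ?\<S>) = 2 ^ m"
    by (simp add: card_image[OF inj] card_Pow)
  moreover have "hyperspace_map f ` hyperspace X \<subseteq> hyperspace X"
    using hyperspace_map_in_hyperspace[OF X _ fX] hom by (auto simp: homeomorphism_def)
  ultimately show ?thesis
    unfolding sep_def
    by (intro Max_ge finite_card_separated_hyperspace[OF X _ m r(1)]) (auto intro!: exI[of _ "A ` ?\<S>"])
qed

lemma pol_entropy_eq_infinity:
  assumes r: "0 < r"
    and sep: "\<And>m \<epsilon>. 1 \<le> m \<Longrightarrow> 0 < \<epsilon> \<Longrightarrow> \<epsilon> \<le> r \<Longrightarrow> 2 ^ m \<le> sep Y d g m \<epsilon>"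
  shows "pol_entropy Y d g = \<infinity>"
proof -
  have lim: "limsup (\<lambda>m. ereal (ln (real (sep Y d g m \<epsilon>)) / ln (real m))) = \<infinity>"
    if \<epsilon>: "0 < \<epsilon>" "\<epsilon> \<le> r" for \<epsilon>
  proof -
    have "filterlim (\<lambda>m. real m * ln 2 / ln (real m)) at_top sequentially"
      by real_asymp
    moreover have "eventually (\<lambda>m. real m * ln 2 / ln (real m)
        \<le> ln (real (sep Y d g m \<epsilon>)) / ln (real m)) sequentially"
      using eventually_ge_at_top[of 2]
    proof eventually_elim
      case (elim m)
      have "real (2 ^ m) \<le> real (sep Y d g m \<epsilon>)"
        using sep[of m \<epsilon>] elim \<epsilon> by (subst of_nat_le_iff) simp
      then have "ln (2 ^ m) \<le> ln (real (sep Y d g m \<epsilon>))"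
        by (intro ln_mono) (simp_all add: order_less_le_trans[of 0 "2 ^ m"])
      then show ?case
        using elim by (intro divide_right_mono) (simp_all add: ln_realpow)
    qed
    ultimately have "filterlim (\<lambda>m. ln (real (sep Y d g m \<epsilon>)) / ln (real m)) at_top sequentially"
      by (rule filterlim_at_top_mono)
    then show ?thesis
      by (intro lim_imp_Limsup) (simp_all add: tendsto_PInfty_eq_at_top)
  qed
  have "eventually (\<lambda>\<epsilon>. \<epsilon> \<in> {0<..<r}) (at_right 0)"
    using r by (rule eventually_at_right_real)
  then have "((\<lambda>\<epsilon>. limsup (\<lambda>m. ereal (ln (real (sep Y d g m \<epsilon>)) / ln (real m)))) \<longlongrightarrow> \<infinity>) (at_right 0)"
    by (intro tendsto_eventually) (auto elim!: eventually_mono simp: lim)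
  then show ?thesis
    unfolding pol_entropy_def by (intro tendsto_Lim) auto
qed

theorem corollary10:
  fixes X :: "'a::metric_space set" and f :: "'a \<Rightarrow> 'a"
  assumes "regular_curve X"
    and "\<exists>g. homeomorphism X X f g"
    and "\<exists>p\<in>X. wandering_point X f p"
  shows "pol_entropy (hyperspace X) hausdorff_dist (hyperspace_map f) = \<infinity>"
proof -
  have X: "compact X"
    using assms(1) by (simp add: regular_curve_def continuum_def)
  obtain g where g: "homeomorphism X X f g"
    using assms(2) by blast
  obtain p U where p: "p \<in> X" "p \<in> top_of_set X interior_of U" and U: "wandering f U"
    using assms(3) by (auto simp: wandering_point_def)
  obtain r where r: "0 < r" "ball p r \<inter> X \<subseteq> U"
    using p(2) unfolding interior_of_def openin_contains_ball by blast
  show ?thesis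
    using sep_hyperspace_ge_power[OF X g U p(1) r(2)] by (intro pol_entropy_eq_infinity[OF r(1)])
qed

end
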